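(* Let $T$ be a conditional expectation on $L^\infty([0,1],\mathcal{B}([0,1]),\lambda)$. Then $T$ preserves or reverses the monotonicity if and only if there exists a countable family of disjoint intervals $((a_k,b_k))_{k\in\mathcal{I}}$ in $(0,1)$ such that, with $P:=\bigcup_{k\in\mathcal{I}}(a_k,b_k)$ and $P^C:=[0,1]\setminus P$, $$Tf(u)=\sum_{k\in\mathcal{I}}\mathbb{1}_{(a_k,b_k)}(u)\,\frac{1}{b_k-a_k}\int_{a_k}^{b_k}f(t)\,\mathrm{d}t+\mathbb{1}_{P^C}(u)f(u)$$ for all $f\in L^\infty([0,1],\mathcal{B}([0,1]),\lambda)$ and almost all $u\in[0,1]$.
   Context: $\lambda$ is Lebesgue measure on $[0,1]$ and $\mathcal{B}([0,1])$ the Borel $\sigma$-algebra. $T$ is a conditional expectation on $L^\infty$ if there is a sub-$\sigma$-algebra $\mathcal{G}\subseteq\mathcal{B}([0,1])$ with $Tf=\mathbb{E}(f\mid\mathcal{G})$ for all $f\in L^\infty$. A function (class) is called decreasing (increasing) if it agrees almost everywhere with a non-strictly decreasing (increasing) function $[0,1]\to\mathbb{R}$. $T$ preserves (reverses) the monotonicity if $T$ maps decreasing functions to decreasing (increasing) functions. The countable family of intervals may be empty (then $T$ is the identity), and the single interval $(0,1)$ is allowed. *)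

theory Defs
  imports "HOL-Probability.Probability"
begin

definition unit_leb :: "real measure"
  where "unit_leb = restrict_space lborel {0..1}"

text \<open>Elements of \<open>L\<^sup>\<infinity>\<close> are handled through representatives: an equality between
  classes is always written as an equality almost everywhere.  The values of a representative
  outside \<open>[0,1]\<close> are irrelevant.\<close>

definition Linf :: "'a measure \<Rightarrow> ('a \<Rightarrow> real) set"
  where "Linf M = {f \<in> borel_measurable M. \<exists>C. AE x in M. \<bar>f x\<bar> \<le> C}"

text \<open>In \<open>subalgebra M G\<close> only the space and the sets of \<open>G\<close> matter; the measure
  carried by \<open>G\<close> is ignored, also by \<open>real_cond_exp\<close>.\<close>

definition cond_exp_operator :: "'a measure \<Rightarrow> (('a \<Rightarrow> real) \<Rightarrow> ('a \<Rightarrow> real)) \<Rightarrow> bool"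
  where "cond_exp_operator M T \<longleftrightarrow>
    T \<in> Linf M \<rightarrow> Linf M \<and>
    (\<exists>G. subalgebra M G \<and> (\<forall>f \<in> Linf M. AE u in M. T f u = real_cond_exp M G f u))"

definition ae_decreasing :: "(real \<Rightarrow> real) \<Rightarrow> bool"
  where "ae_decreasing f \<longleftrightarrow>
    (\<exists>g. antimono_on {0..1} g \<and> (AE u in unit_leb. f u = g u))"

definition ae_increasing :: "(real \<Rightarrow> real) \<Rightarrow> bool"
  where "ae_increasing f \<longleftrightarrow>
    (\<exists>g. mono_on {0..1} g \<and> (AE u in unit_leb. f u = g u))"

definition preserves_monotonicity :: "((real \<Rightarrow> real) \<Rightarrow> (real \<Rightarrow> real)) \<Rightarrow> bool"
  where "preserves_monotonicity T \<longleftrightarrow>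
    (\<forall>f \<in> Linf unit_leb. ae_decreasing f \<longrightarrow> ae_decreasing (T f))"

definition reverses_monotonicity :: "((real \<Rightarrow> real) \<Rightarrow> (real \<Rightarrow> real)) \<Rightarrow> bool"
  where "reverses_monotonicity T \<longleftrightarrow>
    (\<forall>f \<in> Linf unit_leb. ae_decreasing f \<longrightarrow> ae_increasing (T f))"

end

theory Submission
  imports Defs
begin

text \<open>
Averaging over disjoint intervals preserves monotonicity because the average of a decreasing
function over an interval lies between its values at the two endpoints
(\<open>interval_averaging_antimono\<close>).

For the converse write \<open>E f\<close> for the conditional expectation of \<open>f\<close> given \<open>G\<close>; everything is read off
from the \<open>G\<close>-measurable function \<open>E id\<close>.  If \<open>T\<close> preserves monotonicity, then \<open>E id\<close> agrees almost
everywhere with an increasing function \<open>h\<close>.  If \<open>T\<close> reverses it, then \<open>E id\<close> is decreasing while its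
covariance with \<open>id\<close> equals its own variance; as increasing and decreasing functions have nonpositive
covariance, \<open>E id\<close> is constant and again has an increasing version
(\<open>antimono_barycentre_constant\<close>).  The intervals of the theorem are the plateaus of \<open>h\<close>, the
nondegenerate intervals on which it is constant.

On a plateau \<open>J\<close> with value \<open>c\<close>, every integrable \<open>G\<close>-measurable \<open>\<phi>\<close> satisfies
\<open>\<integral>\<^sub>J \<phi>(x) (x - c) dx = \<integral>\<^sub>J \<phi> (E id - c) = 0\<close>.  For \<open>\<phi> = g - g(c)\<close> with \<open>g\<close> monotone the integrand has
constant sign, so \<open>g = g(c)\<close> on \<open>J\<close>
(\<open>monotone_constant_where_barycentre_constant\<close>).  Since each \<open>E 1\<^bsub>(t,\<infinity>)\<^esub>\<close> is monotone, it is constant on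
\<open>J\<close>.  This makes every set of \<open>G\<close> independent of every half line within \<open>J\<close>, hence independent of
itself, so \<open>J\<close> is an atom of \<open>G\<close> (\<open>half_line_constant_imp_atom\<close>) and \<open>E f\<close> is the mean of
\<open>f\<close> there (\<open>E_on_atom\<close>).

Off the plateaus and their countably many endpoints \<open>h\<close> is injective and has a Borel left inverse \<open>k\<close>
(\<open>level_section_inverse\<close>).  There \<open>f = f \<circ> k \<circ> h\<close> is a function of \<open>E id\<close>, so it is
\<open>G\<close>-measurable and \<open>E f = f\<close>.  Both parts are put together in \<open>E_eq_interval_averaging\<close>.
\<close>

section \<open>Lebesgue measure on the unit interval and monotone classes\<close>

lemma space_unit_leb [simp]: "space unit_leb = {0..1}"
  by (simp add: unit_leb_def space_restrict_space)

lemma sets_unit_leb: "A \<in> sets unit_leb \<longleftrightarrow> A \<in> sets borel \<and> A \<subseteq> {0..1}"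
  by (auto simp: unit_leb_def sets_restrict_space_iff)

lemma emeasure_unit_leb: "A \<subseteq> {0..1} \<Longrightarrow> emeasure unit_leb A = emeasure lborel A"
  by (simp add: unit_leb_def emeasure_restrict_space)

lemma measure_unit_leb: "A \<subseteq> {0..1} \<Longrightarrow> measure unit_leb A = measure lborel A"
  by (simp add: measure_def emeasure_unit_leb)

lemma AE_unit_leb_iff: "(AE u in unit_leb. P u) \<longleftrightarrow> (AE u in lborel. u \<in> {0..1} \<longrightarrow> P u)"
  unfolding unit_leb_def by (subst AE_restrict_space_iff) auto

interpretation unit_leb: prob_space unit_leb
  by standard (simp add: emeasure_unit_leb)

lemma borel_measurable_unit_leb:
  "f \<in> borel_measurable borel \<Longrightarrow> f \<in> borel_measurable unit_leb"
  by (simp add: unit_leb_def measurable_restrict_space1)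

lemma borel_measurable_ident_unit_leb [measurable]: "(\<lambda>x. x) \<in> borel_measurable unit_leb"
  by (rule borel_measurable_unit_leb) simp

lemma AE_unit_leb_not_in_countable:
  "countable S \<Longrightarrow> AE u in unit_leb. u \<notin> S"
  unfolding AE_unit_leb_iff
  by (rule AE_mp[OF AE_not_in[OF countable_imp_null_set_lborel]]) auto

lemma AE_unit_leb_in_space: "AE u in unit_leb. u \<in> {0..1}"
  using AE_space[of unit_leb] by simp

lemma set_integral_unit_leb:
  assumes "S \<subseteq> {0..1}"
  shows "(LINT t:S|unit_leb. f t) = (LINT t:S|lborel. (f t :: real))"
  unfolding set_lebesgue_integral_def unit_leb_def
  by (subst integral_restrict_space)
     (use assms in \<open>auto intro!: Bochner_Integration.integral_cong simp: indicator_def\<close>)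

lemma Linf_integrable:
  assumes "f \<in> Linf unit_leb"
  shows "integrable unit_leb f"
proof -
  from assms obtain C where "f \<in> borel_measurable unit_leb" "AE x in unit_leb. \<bar>f x\<bar> \<le> C"
    by (auto simp: Linf_def)
  then show ?thesis
    by (intro unit_leb.integrable_const_bound[where B = C]) simp_all
qed

lemma clamp_01: "max 0 (min 1 x) \<in> {0..1::real}"
  by auto

text \<open>A monotone representative extends to the whole line by freezing it outside the unit interval.
Globally monotone functions are Borel, and can be evaluated at points that are not yet known to lie in
the unit interval.\<close>

lemma ae_decreasing_iff_antimono:
  "ae_decreasing f \<longleftrightarrow> (\<exists>g. antimono g \<and> (AE u in unit_leb. f u = g u))"
proof
  assume "ae_decreasing f"
  then obtain g where g: "antimono_on {0..1} g" "AE u in unit_leb. f u = g u"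
    by (auto simp: ae_decreasing_def)
  define g' where "g' x = g (max 0 (min 1 x))" for x
  have "antimono g'"
    by (rule antimonoI, unfold g'_def, rule monotone_onD[OF g(1) clamp_01 clamp_01]) auto
  moreover have "AE u in unit_leb. f u = g' u"
    using g(2) AE_unit_leb_in_space by eventually_elim (simp add: g'_def)
  ultimately show "\<exists>g. antimono g \<and> (AE u in unit_leb. f u = g u)"
    by blast
next
  assume "\<exists>g. antimono g \<and> (AE u in unit_leb. f u = g u)"
  then show "ae_decreasing f"
    unfolding ae_decreasing_def by (metis monotone_on_subset subset_UNIV)
qed

lemma ae_increasing_iff_ae_decreasing_uminus:
  "ae_increasing f \<longleftrightarrow> ae_decreasing (\<lambda>u. - f u)"
proof
  assume "ae_increasing f"
  then obtain g where g: "mono_on {0..1} g" "AE u in unit_leb. f u = g u"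
    by (auto simp: ae_increasing_def)
  then show "ae_decreasing (\<lambda>u. - f u)"
    unfolding ae_decreasing_def
    by (intro exI[of _ "\<lambda>u. - g u"]) (auto simp: monotone_on_def)
next
  assume "ae_decreasing (\<lambda>u. - f u)"
  then obtain g where g: "antimono_on {0..1} g" "AE u in unit_leb. - f u = g u"
    by (auto simp: ae_decreasing_def)
  have "AE u in unit_leb. f u = - g u"
    using g(2) by eventually_elim simp
  then show "ae_increasing f"
    unfolding ae_increasing_def using g(1)
    by (intro exI[of _ "\<lambda>u. - g u"]) (auto simp: monotone_on_def)
qed

lemma ae_increasing_iff_mono:
  "ae_increasing f \<longleftrightarrow> (\<exists>g. mono g \<and> (AE u in unit_leb. f u = g u))"
proof
  assume "ae_increasing f"
  then obtain g where g: "antimono g" "AE u in unit_leb. - f u = g u"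
    by (auto simp: ae_increasing_iff_ae_decreasing_uminus ae_decreasing_iff_antimono)
  have "mono (\<lambda>u. - g u)"
    using g(1) by (simp add: monotone_def)
  moreover have "AE u in unit_leb. f u = - g u"
    using g(2) by eventually_elim simp
  ultimately show "\<exists>g. mono g \<and> (AE u in unit_leb. f u = g u)"
    by blast
next
  assume "\<exists>g. mono g \<and> (AE u in unit_leb. f u = g u)"
  then show "ae_increasing f"
    unfolding ae_increasing_def by (metis monotone_on_subset subset_UNIV)
qed

lemma mono_in_Linf:
  assumes "mono (f :: real \<Rightarrow> real)"
  shows "f \<in> Linf unit_leb"
proof -
  have "AE u in unit_leb. \<bar>f u\<bar> \<le> \<bar>f 0\<bar> + \<bar>f 1\<bar>"
    using AE_unit_leb_in_space
  proof eventually_elim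
    case (elim u)
    then have "f 0 \<le> f u" "f u \<le> f 1"
      using assms by (auto simp: mono_def)
    then show ?case by linarith
  qed
  then show ?thesis
    unfolding Linf_def using borel_measurable_unit_leb[OF borel_measurable_mono[OF assms]] by blast
qed

lemma uminus_in_Linf: "f \<in> Linf M \<Longrightarrow> (\<lambda>u. - f u) \<in> Linf M"
  by (auto simp: Linf_def)

section \<open>Averaging over disjoint intervals\<close>

text \<open>The two definitions below repeat the formula of the theorem literally, so that it can be folded
into \<open>interval_averaging\<close>.\<close>

definition interval_average :: "real \<Rightarrow> real \<Rightarrow> (real \<Rightarrow> real) \<Rightarrow> real"
  where "interval_average a b f = 1 / (b - a) * (LINT t:{a<..<b}|lborel. f t)"

definition interval_averaging ::
    "nat set \<Rightarrow> (nat \<Rightarrow> real) \<Rightarrow> (nat \<Rightarrow> real) \<Rightarrow> (real \<Rightarrow> real) \<Rightarrow> real \<Rightarrow> real"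
  where "interval_averaging I a b f u =
    (\<Sum>\<^sub>\<infinity>k\<in>I. indicator {a k<..<b k} u * interval_average (a k) (b k) f)
    + indicator ({0..1} - (\<Union>k\<in>I. {a k<..<b k})) u * f u"

lemma interval_averaging_inside:
  assumes "disjoint_family_on (\<lambda>k. {a k<..<b k}) I" "k \<in> I" "u \<in> {a k<..<b k}"
  shows "interval_averaging I a b f u = interval_average (a k) (b k) f"
proof -
  have "u \<notin> {a j<..<b j}" if "j \<in> I" "j \<noteq> k" for j
    using assms that unfolding disjoint_family_on_def by blast
  then have "(\<Sum>\<^sub>\<infinity>j\<in>I. indicator {a j<..<b j} u * interval_average (a j) (b j) f) =
      (\<Sum>\<^sub>\<infinity>j\<in>{k}. indicator {a j<..<b j} u * interval_average (a j) (b j) f)"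
    using assms(2) by (intro infsum_cong_neutral) auto
  also have "\<dots> = interval_average (a k) (b k) f"
    using assms(3) by simp
  finally show ?thesis
    using assms(2,3) by (auto simp: interval_averaging_def indicator_def)
qed

lemma interval_averaging_outside:
  assumes "u \<in> {0..1}" "u \<notin> (\<Union>k\<in>I. {a k<..<b k})"
  shows "interval_averaging I a b f u = f u"
proof -
  have "(\<Sum>\<^sub>\<infinity>j\<in>I. indicator {a j<..<b j} u * interval_average (a j) (b j) f) = 0"
    using assms(2) by (intro infsum_0) auto
  then show ?thesis
    using assms by (simp add: interval_averaging_def)
qed

lemma interval_average_cong_AE:
  assumes "f \<in> borel_measurable unit_leb" "g \<in> borel_measurable unit_leb"
    and "AE u in unit_leb. f u = g u" "0 \<le> a" "b \<le> 1"
  shows "interval_average a b f = interval_average a b g"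
proof -
  have S: "{a<..<b} \<subseteq> {0..1}"
    using assms by auto
  then have [measurable]: "{a<..<b} \<in> sets unit_leb"
    by (simp add: sets_unit_leb)
  note [measurable] = assms(1,2)
  have "(LINT t:{a<..<b}|unit_leb. f t) = (LINT t:{a<..<b}|unit_leb. g t)"
    by (rule set_lebesgue_integral_cong_AE) (use assms(3) in auto)
  then show ?thesis
    by (simp add: interval_average_def set_integral_unit_leb[OF S])
qed

lemma interval_average_bounds:
  assumes "antimono g" "a < b" "0 \<le> a" "b \<le> 1"
  shows "g b \<le> interval_average a b g" "interval_average a b g \<le> g a"
proof -
  have S: "{a<..<b} \<subseteq> {0..1}"
    using assms by auto
  then have meas: "{a<..<b} \<in> sets unit_leb"
    by (simp add: sets_unit_leb)
  have "mono (\<lambda>u. - g u)"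
    using assms(1) by (simp add: monotone_def)
  from uminus_in_Linf[OF mono_in_Linf[OF this]] have int: "integrable unit_leb g"
    by (auto intro: Linf_integrable)
  have c: "(LINT t:{a<..<b}|unit_leb. c) = (b - a) * c" for c :: real
    using assms(2) by (simp add: set_integral_unit_leb[OF S] set_integral_const)
  have ints: "set_integrable unit_leb {a<..<b} g" "set_integrable unit_leb {a<..<b} (\<lambda>_. c)" for c :: real
    unfolding set_integrable_def
    by (rule integrable_mult_indicator[OF meas int], rule integrable_mult_indicator[OF meas]) simp
  have "(LINT t:{a<..<b}|unit_leb. g b) \<le> (LINT t:{a<..<b}|unit_leb. g t)"
    by (rule set_integral_mono[OF ints(2) ints(1)]) (use assms(1) in \<open>auto simp: monotone_def\<close>)
  moreover have "(LINT t:{a<..<b}|unit_leb. g t) \<le> (LINT t:{a<..<b}|unit_leb. g a)"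
    by (rule set_integral_mono[OF ints(1) ints(2)]) (use assms(1) in \<open>auto simp: monotone_def\<close>)
  ultimately show "g b \<le> interval_average a b g" "interval_average a b g \<le> g a"
    using assms(2) unfolding interval_average_def c set_integral_unit_leb[OF S]
    by (simp_all add: field_simps)
qed

text \<open>On an interval the averaged function lies between the values of \<open>g\<close> at the endpoints, and outside
it equals \<open>g\<close>.  Two points that share no interval are separated by the endpoints involved,
so the order of those values decides.\<close>

lemma interval_averaging_antimono:
  assumes g: "antimono g"
    and ab: "\<And>k. k \<in> I \<Longrightarrow> 0 \<le> a k \<and> a k < b k \<and> b k \<le> 1"
    and disj: "disjoint_family_on (\<lambda>k. {a k<..<b k}) I"
  shows "antimono_on {0..1} (interval_averaging I a b g)"
proof (rule monotone_onI)
  let ?R = "interval_averaging I a b g" and ?P = "\<Union>k\<in>I. {a k<..<b k}"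
  fix u v :: real
  assume uv: "u \<in> {0..1}" "v \<in> {0..1}" "u \<le> v"
  have bounds: "g (b k) \<le> ?R w \<and> ?R w \<le> g (a k)" if "k \<in> I" "w \<in> {a k<..<b k}" for k w
    using interval_average_bounds[OF g, of "a k" "b k"] ab[OF that(1)]
      interval_averaging_inside[OF disj that] by auto
  have anti: "x \<le> y \<Longrightarrow> g y \<le> g x" for x y
    using g by (auto simp: monotone_def)
  show "?R u \<ge> ?R v"
  proof (cases "\<exists>k\<in>I. u \<in> {a k<..<b k}")
    case True
    then obtain k where k: "k \<in> I" "u \<in> {a k<..<b k}" by auto
    show ?thesis
    proof (cases "v \<in> {a k<..<b k}")
      case True
      then show ?thesis
        using interval_averaging_inside[OF disj k(1)] k(2) by simp
    next
      case False
      with k uv have bv: "b k \<le> v" by auto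
      show ?thesis
      proof (cases "\<exists>l\<in>I. v \<in> {a l<..<b l}")
        case True
        then obtain l where l: "l \<in> I" "v \<in> {a l<..<b l}" by auto
        \<comment> \<open>Different intervals are ordered like \<open>u\<close> and \<open>v\<close>: otherwise a point just below \<open>b k\<close>
          would lie in both.\<close>
        have "b k \<le> a l"
        proof (rule ccontr)
          assume "\<not> b k \<le> a l"
          then obtain w where "max (a k) (a l) < w" "w < b k"
            using dense[of "max (a k) (a l)" "b k"] ab[OF k(1)] by auto
          with l bv have "w \<in> {a k<..<b k} \<inter> {a l<..<b l}" by auto
          moreover have "k \<noteq> l" using l False by auto
          ultimately show False
            using disj k(1) l(1) unfolding disjoint_family_on_def by blast
        qed
        then show ?thesis
          using bounds[OF k] bounds[OF l] anti by (meson order_trans)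
      next
        case False
        then have "?R v = g v"
          using uv by (intro interval_averaging_outside) auto
        then show ?thesis
          using bounds[OF k] anti[OF bv] by simp
      qed
    qed
  next
    case uout: False
    then have Ru: "?R u = g u"
      using uv by (intro interval_averaging_outside) auto
    show ?thesis
    proof (cases "\<exists>l\<in>I. v \<in> {a l<..<b l}")
      case True
      then obtain l where l: "l \<in> I" "v \<in> {a l<..<b l}" by auto
      with uout uv have "u \<le> a l" by auto
      then show ?thesis
        using bounds[OF l] anti Ru by (metis order_trans)
    next
      case False
      then have "?R v = g v"
        using uv by (intro interval_averaging_outside) auto
      then show ?thesis
        using Ru anti[OF uv(3)] by simp
    qed
  qed
qed

lemma interval_averaging_cong_AE:
  assumes "f \<in> borel_measurable unit_leb" "g \<in> borel_measurable unit_leb"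
    and eq: "AE u in unit_leb. f u = g u"
    and ab: "\<And>k. k \<in> I \<Longrightarrow> 0 \<le> a k \<and> b k \<le> 1"
  shows "AE u in unit_leb. interval_averaging I a b f u = interval_averaging I a b g u"
  using eq
proof eventually_elim
  case (elim u)
  have "(\<Sum>\<^sub>\<infinity>k\<in>I. indicator {a k<..<b k} u * interval_average (a k) (b k) f) =
        (\<Sum>\<^sub>\<infinity>k\<in>I. indicator {a k<..<b k} u * interval_average (a k) (b k) g)"
    using interval_average_cong_AE[OF assms(1-3)] ab by (intro infsum_cong) simp
  then show ?case
    by (simp add: interval_averaging_def elim)
qed

lemma preserves_monotonicity_interval_averaging:
  assumes ab: "\<And>k. k \<in> I \<Longrightarrow> 0 \<le> a k \<and> a k < b k \<and> b k \<le> 1"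
    and disj: "disjoint_family_on (\<lambda>k. {a k<..<b k}) I"
    and T: "\<And>f. f \<in> Linf unit_leb \<Longrightarrow>
      AE u in unit_leb. T f u = interval_averaging I a b f u"
  shows "preserves_monotonicity T"
  unfolding preserves_monotonicity_def
proof (intro ballI impI)
  fix f assume f: "f \<in> Linf unit_leb" and "ae_decreasing f"
  then obtain g where g: "antimono g" "AE u in unit_leb. f u = g u"
    by (auto simp: ae_decreasing_iff_antimono)
  have "mono (\<lambda>u. - g u)"
    using g(1) by (simp add: monotone_def)
  from uminus_in_Linf[OF mono_in_Linf[OF this]] have "g \<in> borel_measurable unit_leb"
    by (simp add: Linf_def)
  moreover have "f \<in> borel_measurable unit_leb"
    using f by (simp add: Linf_def)
  ultimately have "AE u in unit_leb. interval_averaging I a b f u = interval_averaging I a b g u"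
    using g(2) ab by (intro interval_averaging_cong_AE) auto
  with T[OF f] have "AE u in unit_leb. T f u = interval_averaging I a b g u"
    by eventually_elim simp
  then show "ae_decreasing (T f)"
    using interval_averaging_antimono[OF g(1) ab disj] by (auto simp: ae_decreasing_def)
qed

section \<open>Plateaus of a monotone function\<close>

text \<open>A plateau is indexed by the value taken on it, which makes different plateaus disjoint and their
countability a statement about levels.\<close>

definition plateau_levels :: "(real \<Rightarrow> real) \<Rightarrow> real set"
  where "plateau_levels h = {c. \<exists>u\<in>{0..1}. \<exists>v\<in>{0..1}. u < v \<and> h u = c \<and> h v = c}"

definition plateau_inf :: "(real \<Rightarrow> real) \<Rightarrow> real \<Rightarrow> real"
  where "plateau_inf h c = Inf {x\<in>{0..1}. h x = c}"

definition plateau_sup :: "(real \<Rightarrow> real) \<Rightarrow> real \<Rightarrow> real"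
  where "plateau_sup h c = Sup {x\<in>{0..1}. h x = c}"

abbreviation plateau :: "(real \<Rightarrow> real) \<Rightarrow> real \<Rightarrow> real set"
  where "plateau h c \<equiv> {plateau_inf h c<..<plateau_sup h c}"

lemma plateau_bounds:
  assumes "u \<in> {0..1}" "h u = c"
  shows "plateau_inf h c \<le> u" "u \<le> plateau_sup h c"
  unfolding plateau_inf_def plateau_sup_def using assms
  by (auto intro!: cInf_lower cSup_upper bdd_belowI[of _ 0] bdd_aboveI[of _ 1])

lemma plateau_endpoints:
  assumes "c \<in> plateau_levels h"
  shows "0 \<le> plateau_inf h c" "plateau_inf h c < plateau_sup h c" "plateau_sup h c \<le> 1"
proof -
  from assms obtain u v where uv: "u \<in> {0..1}" "v \<in> {0..1}" "u < v" "h u = c" "h v = c"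
    by (auto simp: plateau_levels_def)
  then have ne: "{x\<in>{0..1}. h x = c} \<noteq> {}" by auto
  show "0 \<le> plateau_inf h c"
    unfolding plateau_inf_def using ne by (intro cInf_greatest) auto
  show "plateau_sup h c \<le> 1"
    unfolding plateau_sup_def using ne by (intro cSup_least) auto
  show "plateau_inf h c < plateau_sup h c"
    using plateau_bounds(1)[of u h c] plateau_bounds(2)[of v h c] uv by simp
qed

lemma constant_on_plateau:
  assumes h: "mono h" and c: "c \<in> plateau_levels h" and x: "x \<in> plateau h c"
  shows "h x = c" "x \<in> {0..1}"
proof -
  from c have ne: "{x\<in>{0..1}. h x = c} \<noteq> {}" by (auto simp: plateau_levels_def)
  from x obtain y where y: "y \<in> {x\<in>{0..1}. h x = c}" "y < x"
    using cInf_lessD[OF ne] by (auto simp: plateau_inf_def)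
  from x obtain z where z: "z \<in> {x\<in>{0..1}. h x = c}" "x < z"
    using less_cSupD[OF ne] by (auto simp: plateau_sup_def)
  have "h y \<le> h x" "h x \<le> h z"
    using monoD[OF h, of y x] monoD[OF h, of x z] y z by auto
  then show "h x = c" "x \<in> {0..1}"
    using y z by auto
qed

lemma disjoint_plateaus:
  assumes "mono h"
  shows "disjoint_family_on (plateau h) (plateau_levels h)"
  unfolding disjoint_family_on_def
  using constant_on_plateau(1)[OF assms] by blast

text \<open>Distinct levels give disjoint nonempty open intervals, and the line is second countable.\<close>

lemma countable_plateau_levels:
  assumes "mono h"
  shows "countable (plateau_levels h)"
proof -
  have inj: "inj_on (plateau h) (plateau_levels h)"
  proof (rule inj_onI)
    fix c d assume cd: "c \<in> plateau_levels h" "d \<in> plateau_levels h" "plateau h c = plateau h d"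
    obtain x where "x \<in> plateau h c"
      using dense[OF plateau_endpoints(2)[OF cd(1)]] by auto
    then show "c = d"
      using constant_on_plateau(1)[OF assms] cd by metis
  qed
  have "pairwise disjnt (plateau h ` plateau_levels h)"
    using disjoint_plateaus[OF assms]
    by (auto simp: pairwise_def disjnt_def disjoint_family_on_def)
  then have "countable (plateau h ` plateau_levels h)"
    by (intro countable_disjoint_open_subsets) auto
  then show ?thesis
    using inj by (rule countable_image_inj_on)
qed

text \<open>A generalised inverse of an increasing \<open>h\<close>.  The point \<open>0\<close> is inserted to give a value in the unit
interval, and to keep monotonicity, also at levels below the range of \<open>h\<close>.\<close>

definition level_section :: "(real \<Rightarrow> real) \<Rightarrow> real \<Rightarrow> real"
  where "level_section h y = Sup (insert 0 {x\<in>{0..1}. h x \<le> y})"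

lemma level_section_bounds: "level_section h y \<in> {0..1}"
  unfolding level_section_def
  by (auto intro!: cSup_upper cSup_least bdd_aboveI[of _ 1])

lemma mono_level_section: "mono (level_section h)"
  unfolding level_section_def
  by (intro monoI cSup_subset_mono) (auto intro!: bdd_aboveI[of _ 1])

text \<open>On the unit interval \<open>h\<close> takes a value that is not a plateau level at most once, so the points there
with value at most \<open>h u\<close> are exactly those up to \<open>u\<close>.\<close>

lemma level_section_inverse:
  assumes h: "mono h" and u: "u \<in> {0..1}" "h u \<notin> plateau_levels h"
  shows "level_section h (h u) = u"
proof -
  have "x \<le> u" if "x \<in> {0..1}" "h x \<le> h u" for x
  proof (rule ccontr)
    assume "\<not> x \<le> u"
    moreover from this have "h x = h u"
      using h that by (intro antisym) (auto simp: mono_def)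
    ultimately have "u < x" "h x = h u" by auto
    then have "h u \<in> plateau_levels h"
      using u(1) that(1) unfolding plateau_levels_def by blast
    with u(2) show False by simp
  qed
  then show ?thesis
    unfolding level_section_def using u(1) by (intro cSup_eq_maximum) auto
qed

section \<open>Conditional expectations on the unit interval\<close>

locale unit_subalgebra =
  fixes G :: "real measure"
  assumes subalgebra_G: "subalgebra unit_leb G"

sublocale unit_subalgebra \<subseteq> finite_measure_subalgebra unit_leb G
  by standard (fact subalgebra_G)

context unit_subalgebra
begin

abbreviation E :: "(real \<Rightarrow> real) \<Rightarrow> real \<Rightarrow> real"
  where "E \<equiv> real_cond_exp unit_leb G"

lemma sets_G: "A \<in> sets G \<Longrightarrow> A \<in> sets unit_leb"
  using subalgebra_G by (auto simp: subalgebra_def)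

lemma space_G [simp]: "space G = {0..1}"
  using subalgebra_G by (auto simp: subalgebra_def)

lemma integrable_ident: "integrable unit_leb (\<lambda>x. x)"
  by (rule Linf_integrable[OF mono_in_Linf]) (simp add: mono_def)

lemma E_ident_diff: "AE x in unit_leb. E (\<lambda>x. x - c) x = E (\<lambda>x. x) x - c"
proof -
  have "AE x in unit_leb. E (\<lambda>x. x - c) x = E (\<lambda>x. x) x - E (\<lambda>x. c) x"
    by (rule real_cond_exp_diff) (auto simp: integrable_ident)
  moreover have "AE x in unit_leb. E (\<lambda>x. c) x = c"
    by (rule real_cond_exp_F_meas) auto
  ultimately show ?thesis
    by eventually_elim simp
qed

text \<open>The source of all information about \<open>G\<close>: against a \<open>G\<close>-measurable weight, the identity may be
replaced by its conditional expectation.\<close>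

lemma integral_mult_centred_ident:
  assumes [measurable]: "\<phi> \<in> borel_measurable G" and int: "integrable unit_leb \<phi>"
  shows "integrable unit_leb (\<lambda>x. \<phi> x * (x - c))"
    and "integrable unit_leb (\<lambda>x. \<phi> x * (E (\<lambda>x. x) x - c))"
    and "(\<integral>x. \<phi> x * (x - c) \<partial>unit_leb) = (\<integral>x. \<phi> x * (E (\<lambda>x. x) x - c) \<partial>unit_leb)"
proof -
  have [measurable]: "\<phi> \<in> borel_measurable unit_leb"
    using int by simp
  show 1: "integrable unit_leb (\<lambda>x. \<phi> x * (x - c))"
  proof (rule Bochner_Integration.integrable_bound)
    show "integrable unit_leb (\<lambda>x. (1 + \<bar>c\<bar>) * \<phi> x)"
      using int by simp
    show "AE x in unit_leb. norm (\<phi> x * (x - c)) \<le> norm ((1 + \<bar>c\<bar>) * \<phi> x)"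
      using AE_unit_leb_in_space
    proof eventually_elim
      case (elim x)
      then have "\<bar>x - c\<bar> \<le> 1 + \<bar>c\<bar>" by auto
      then have "\<bar>x - c\<bar> * \<bar>\<phi> x\<bar> \<le> (1 + \<bar>c\<bar>) * \<bar>\<phi> x\<bar>"
        by (rule mult_right_mono) simp
      then show ?case by (simp add: abs_mult mult.commute)
    qed
  qed measurable
  have eq: "AE x in unit_leb. \<phi> x * E (\<lambda>x. x - c) x = \<phi> x * (E (\<lambda>x. x) x - c)"
    using E_ident_diff[of c] by eventually_elim simp
  have m: "(\<lambda>x. x - c) \<in> borel_measurable unit_leb" by measurable
  note i = real_cond_exp_intg[OF 1 assms(1) m]
  show "integrable unit_leb (\<lambda>x. \<phi> x * (E (\<lambda>x. x) x - c))"
    using i(1) eq by (subst (asm) integrable_cong_AE) (auto simp: borel_measurable_integrable)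
  show "(\<integral>x. \<phi> x * (x - c) \<partial>unit_leb) = (\<integral>x. \<phi> x * (E (\<lambda>x. x) x - c) \<partial>unit_leb)"
    unfolding i(2)[symmetric] by (rule integral_cong_AE) (use eq in auto)
qed

text \<open>The weight \<open>\<phi>\<close> given by \<open>\<psi> - g(c)\<close> on \<open>J\<close> satisfies \<open>\<integral> \<phi>(x) (x - c) = \<integral> \<phi> (E id - c) = 0\<close>,
because \<open>E id = c\<close> on \<open>J\<close>.  By monotonicity of \<open>g\<close> the integrand on the left has constant sign, hence
vanishes almost everywhere.\<close>

lemma monotone_constant_where_barycentre_constant:
  fixes \<psi> g :: "real \<Rightarrow> real"
  assumes J: "J \<in> sets G" and c: "AE x in unit_leb. x \<in> J \<longrightarrow> E (\<lambda>x. x) x = c"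
    and \<psi> [measurable]: "\<psi> \<in> borel_measurable G" and int: "integrable unit_leb \<psi>"
    and g: "mono g \<or> antimono g" "AE x in unit_leb. \<psi> x = g x"
  shows "AE x in unit_leb. x \<in> J \<longrightarrow> \<psi> x = g c"
proof -
  have mono_case: "AE x in unit_leb. x \<in> J \<longrightarrow> \<psi> x = g c"
    if [measurable]: "\<psi> \<in> borel_measurable G" and int: "integrable unit_leb \<psi>"
      and g: "mono g" "AE x in unit_leb. \<psi> x = g x" for \<psi> g :: "real \<Rightarrow> real"
  proof -
    define \<phi> where "\<phi> = (\<lambda>x. indicator J x * (\<psi> x - g c))"
    note [measurable] = J
    have \<phi>G: "\<phi> \<in> borel_measurable G"
      unfolding \<phi>_def by measurable
    have "integrable unit_leb \<phi>"
      unfolding \<phi>_def using int integrable_mult_indicator[OF sets_G[OF J], of "\<lambda>x. \<psi> x - g c"]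
      by simp
    note i = integral_mult_centred_ident[OF \<phi>G this, of c]
    have "(\<integral>x. \<phi> x * (x - c) \<partial>unit_leb) = 0"
      unfolding i(3) by (rule integral_eq_zero_AE) (use c in eventually_elim, auto simp: \<phi>_def indicator_def)
    moreover have "AE x in unit_leb. 0 \<le> \<phi> x * (x - c)"
      using g(2)
    proof eventually_elim
      case (elim x)
      have "0 \<le> (g x - g c) * (x - c)"
        using g(1) by (cases "c \<le> x") (auto simp: mono_def intro!: mult_nonpos_nonpos)
      then show ?case
        by (simp add: \<phi>_def elim indicator_def)
    qed
    ultimately have "AE x in unit_leb. \<phi> x * (x - c) = 0"
      using integral_nonneg_eq_0_iff_AE[OF i(1)] by blast
    then show ?thesis
      using AE_unit_leb_not_in_countable[of "{c}", simplified]
      by eventually_elim (auto simp: \<phi>_def)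
  qed
  show ?thesis
  proof (cases "mono g")
    case True
    then show ?thesis using mono_case[OF \<psi> int] g(2) by blast
  next
    case False
    with g(1) have "antimono g" by blast
    then have "mono (\<lambda>x. - g x)"
      by (simp add: monotone_def)
    moreover have "AE x in unit_leb. - \<psi> x = - g x"
      using g(2) by eventually_elim simp
    ultimately show ?thesis
      using mono_case[of "\<lambda>x. - \<psi> x" "\<lambda>x. - g x"] int by simp
  qed
qed

text \<open>With \<open>m\<close> the common mean of \<open>id\<close> and \<open>E id\<close>, the integral of \<open>(E id - h(m)) (x - m)\<close> is
nonpositive, as \<open>h\<close> decreases.  Replacing \<open>x\<close> by \<open>E id\<close> and then \<open>h(m)\<close> by \<open>m\<close>, which changes nothing
because \<open>E id - m\<close> has mean zero, turns it into the variance of \<open>E id\<close>.\<close>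

lemma antimono_barycentre_constant:
  assumes h: "antimono h" "AE x in unit_leb. E (\<lambda>x. x) x = h x"
  shows "\<exists>m. AE x in unit_leb. E (\<lambda>x. x) x = m"
proof -
  define m where "m = (\<integral>x. x \<partial>unit_leb)"
  let ?\<psi> = "E (\<lambda>x. x)"
  have int\<psi>: "integrable unit_leb ?\<psi>" and E\<psi>: "(\<integral>x. ?\<psi> x \<partial>unit_leb) = m"
    using real_cond_exp_int[OF integrable_ident] by (auto simp: m_def)
  have int1: "integrable unit_leb (\<lambda>x. ?\<psi> x - c)" for c
    using int\<psi> by simp
  have G1: "(\<lambda>x. ?\<psi> x - c) \<in> borel_measurable G" for c
    by measurable
  note i = integral_mult_centred_ident[OF G1 int1, where c = m]
  have "AE x in unit_leb. 0 \<le> - ((?\<psi> x - h m) * (x - m))"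
    using h(2)
  proof eventually_elim
    case (elim x)
    then show ?case
      using h(1) by (cases "m \<le> x") (auto simp: monotone_def mult_nonpos_nonneg mult_nonneg_nonpos)
  qed
  then have "0 \<le> (\<integral>x. - ((?\<psi> x - h m) * (x - m)) \<partial>unit_leb)"
    by (rule integral_nonneg_AE)
  then have "(\<integral>x. (?\<psi> x - h m) * (x - m) \<partial>unit_leb) \<le> 0"
    by simp
  then have "(\<integral>x. (?\<psi> x - h m) * (?\<psi> x - m) \<partial>unit_leb) \<le> 0"
    unfolding i(3) .
  moreover have "(\<integral>x. (?\<psi> x - h m) * (?\<psi> x - m) \<partial>unit_leb) =
      (\<integral>x. (?\<psi> x - m) * (?\<psi> x - m) + (m - h m) * (?\<psi> x - m) \<partial>unit_leb)"
    by (rule Bochner_Integration.integral_cong) (auto simp: algebra_simps)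
  moreover have "\<dots> = (\<integral>x. (?\<psi> x - m) * (?\<psi> x - m) \<partial>unit_leb) +
      (\<integral>x. (m - h m) * (?\<psi> x - m) \<partial>unit_leb)"
    using i(2) int1 by (intro Bochner_Integration.integral_add) auto
  moreover have "(\<integral>x. (m - h m) * (?\<psi> x - m) \<partial>unit_leb) = 0"
    using int\<psi> E\<psi> unit_leb.prob_space by simp
  moreover have "(\<integral>x. (?\<psi> x - m) * (?\<psi> x - m) \<partial>unit_leb) \<ge> 0"
    by (rule integral_nonneg_AE) simp
  ultimately have "(\<integral>x. (?\<psi> x - m) * (?\<psi> x - m) \<partial>unit_leb) = 0"
    by linarith
  then have "AE x in unit_leb. (?\<psi> x - m) * (?\<psi> x - m) = 0"
    using integral_nonneg_eq_0_iff_AE[OF i(2)[of m]] by simp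
  then have "AE x in unit_leb. ?\<psi> x = m"
    by eventually_elim simp
  then show ?thesis ..
qed

text \<open>If \<open>E 1\<^bsub>(t,\<infinity>)\<^esub>\<close> is constant on \<open>J\<close>, then
\<open>\<mu>(J) \<mu>(A \<inter> J \<inter> (t,\<infinity>)) = \<mu>(A \<inter> J) \<mu>(J \<inter> (t,\<infinity>))\<close> for \<open>A\<close> in \<open>G\<close>.  Half lines determine a finite Borel
measure, so any Borel set may replace \<open>(t,\<infinity>)\<close>; choosing \<open>A\<close> itself gives
\<open>\<mu>(J) \<mu>(A \<inter> J) = \<mu>(A \<inter> J)\<^sup>2\<close>.\<close>

lemma half_line_constant_imp_atom:
  assumes J: "J \<in> sets G" and A: "A \<in> sets G"
    and const: "\<And>t. \<exists>d. AE x in unit_leb. x \<in> J \<longrightarrow> E (indicator {t<..}) x = d"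
  shows "measure unit_leb (A \<inter> J) = 0 \<or> measure unit_leb (A \<inter> J) = measure unit_leb J"
proof -
  let ?\<mu> = "measure unit_leb"
  have JA: "J \<in> sets borel" "A \<in> sets borel" "J \<subseteq> {0..1}" "A \<subseteq> {0..1}"
    using sets_G[OF J] sets_G[OF A] by (auto simp: sets_unit_leb)
  note [measurable] = JA(1,2)
  have half: "\<exists>d. \<forall>B\<in>sets G. ?\<mu> (B \<inter> J \<inter> {t<..}) = d * ?\<mu> (B \<inter> J)" for t
  proof -
    from const[of t] obtain d where d: "AE x in unit_leb. x \<in> J \<longrightarrow> E (indicator {t<..}) x = d"
      by blast
    have "?\<mu> (B \<inter> J \<inter> {t<..}) = d * ?\<mu> (B \<inter> J)" if B: "B \<in> sets G" for B
    proof -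
      have BJ: "B \<inter> J \<in> sets G" using B J by auto
      note BJ' = sets_G[OF BJ]
      have "?\<mu> (B \<inter> J \<inter> {t<..}) = (LINT x:B \<inter> J|unit_leb. indicator {t<..} x)"
      proof -
        have "B \<inter> J \<inter> {t<..} \<inter> space unit_leb = B \<inter> J \<inter> {t<..}"
          using JA by auto
        moreover have "indicator (B \<inter> J) x *\<^sub>R indicator {t<..} x = (indicator (B \<inter> J \<inter> {t<..}) x :: real)" for x
          by (simp add: indicator_def)
        ultimately show ?thesis
          unfolding set_lebesgue_integral_def by simp
      qed
      also have "\<dots> = (LINT x:B \<inter> J|unit_leb. E (indicator {t<..}) x)"
        by (rule real_cond_exp_intA[OF _ BJ]) (auto intro!: Linf_integrable mono_in_Linf simp: mono_def indicator_def)
      also have "\<dots> = (LINT x:B \<inter> J|unit_leb. d)"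
        using BJ' d by (intro set_lebesgue_integral_cong_AE) auto
      also have "\<dots> = d * ?\<mu> (B \<inter> J)"
        using BJ' by (subst set_integral_const) auto
      finally show ?thesis .
    qed
    then show ?thesis by blast
  qed
  have eq: "?\<mu> J * ?\<mu> (A \<inter> J \<inter> {t<..}) = ?\<mu> (A \<inter> J) * ?\<mu> (J \<inter> {t<..})" for t
  proof -
    from half[of t] obtain d where d: "\<forall>B\<in>sets G. ?\<mu> (B \<inter> J \<inter> {t<..}) = d * ?\<mu> (B \<inter> J)" ..
    have "?\<mu> (J \<inter> {t<..}) = d * ?\<mu> J"
      using d[rule_format, OF J] by simp
    then show ?thesis
      using d[rule_format, OF A] by simp
  qed
  \<comment> \<open>The measures \<open>B \<mapsto> r \<mu>(S \<inter> B)\<close> on the whole line; the previous identity compares two of them on half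
    lines.\<close>
  define N where "N r S = density lborel (\<lambda>x. ennreal r * indicator S x)" for r and S :: "real set"
  have emN: "emeasure (N r S) B = ennreal (r * ?\<mu> (S \<inter> B))"
    if "S \<in> sets borel" "S \<subseteq> {0..1}" "B \<in> sets borel" "r \<ge> 0" for r S B
  proof -
    have "S \<inter> B \<subseteq> {0..1}" using that by auto
    have "emeasure (N r S) B = (\<integral>\<^sup>+x. ennreal r * indicator (S \<inter> B) x \<partial>lborel)"
      unfolding N_def using that
      by (subst emeasure_density) (auto intro!: nn_integral_cong simp: indicator_def)
    also have "\<dots> = ennreal r * emeasure lborel (S \<inter> B)"
      using that by (subst nn_integral_cmult_indicator) auto
    also have "\<dots> = ennreal r * ennreal (?\<mu> (S \<inter> B))"
      using \<open>S \<inter> B \<subseteq> {0..1}\<close>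
      by (simp flip: emeasure_unit_leb add: unit_leb.emeasure_eq_measure)
    finally show ?thesis using that by (simp add: ennreal_mult)
  qed
  have "N (?\<mu> J) (A \<inter> J) = N (?\<mu> (A \<inter> J)) J"
  proof (rule measure_eqI_lessThan)
    show "sets (N (?\<mu> J) (A \<inter> J)) = sets borel" "sets (N (?\<mu> (A \<inter> J)) J) = sets borel"
      by (auto simp: N_def)
    show "emeasure (N (?\<mu> J) (A \<inter> J)) {t<..} < \<infinity>" for t
      using JA by (subst emN) auto
    show "emeasure (N (?\<mu> J) (A \<inter> J)) {t<..} = emeasure (N (?\<mu> (A \<inter> J)) J) {t<..}" for t
      using JA eq[of t] by (subst (1 2) emN) auto
  qed
  then have "emeasure (N (?\<mu> J) (A \<inter> J)) A = emeasure (N (?\<mu> (A \<inter> J)) J) A"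
    by simp
  then have "?\<mu> J * ?\<mu> (A \<inter> J) = ?\<mu> (A \<inter> J) * ?\<mu> (A \<inter> J)"
    using JA by (subst (asm) (1 2) emN) (auto simp: Int_ac Int_absorb2)
  then show ?thesis by auto
qed

text \<open>The constant \<open>d\<close> has the right integral over each \<open>A \<inter> J\<close> with \<open>A\<close> in \<open>G\<close>, since up to null sets
\<open>A \<inter> J\<close> is either empty or all of \<open>J\<close>.\<close>

lemma E_on_atom:
  assumes J: "J \<in> sets G" and pos: "measure unit_leb J \<noteq> 0"
    and atom: "\<And>A. A \<in> sets G \<Longrightarrow>
      measure unit_leb (A \<inter> J) = 0 \<or> measure unit_leb (A \<inter> J) = measure unit_leb J"
    and f: "integrable unit_leb f"
  shows "AE x in unit_leb. x \<in> J \<longrightarrow> E f x = (LINT t:J|unit_leb. f t) / measure unit_leb J"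
proof -
  define d where "d = (LINT t:J|unit_leb. f t) / measure unit_leb J"
  note JM = sets_G[OF J]
  note [measurable] = J
  have fm [measurable]: "f \<in> borel_measurable unit_leb" using f by simp
  have intJf: "integrable unit_leb (\<lambda>x. indicator J x * f x)"
    using integrable_mult_indicator[OF JM f] by simp
  have "AE x in unit_leb. E (\<lambda>x. indicator J x * f x) x = indicator J x * d"
  proof (rule real_cond_exp_charact)
    show "integrable unit_leb (\<lambda>x. indicator J x * f x)" by (fact intJf)
    show "integrable unit_leb (\<lambda>x. indicator J x * d)"
      using integrable_mult_indicator[OF JM, of "\<lambda>_. d"] by simp
    show "(\<lambda>x. indicator J x * d) \<in> borel_measurable G" by measurable
  next
    fix A assume A: "A \<in> sets G"
    note AM = sets_G[OF A]
    have AJM: "A \<inter> J \<in> sets unit_leb" using AM JM by auto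
    have "(LINT x:A|unit_leb. indicator J x * \<phi> x) = (LINT x:A \<inter> J|unit_leb. \<phi> x)"
      for \<phi> :: "real \<Rightarrow> real"
      unfolding set_lebesgue_integral_def
      by (rule Bochner_Integration.integral_cong) (auto simp: indicator_def)
    note restrict = this
    have "(LINT x:A \<inter> J|unit_leb. f x) = (LINT x:A \<inter> J|unit_leb. d)"
      using atom[OF A]
    proof
      assume "measure unit_leb (A \<inter> J) = 0"
      then have "A \<inter> J \<in> null_sets unit_leb"
        using AJM by (auto simp: null_sets_def unit_leb.emeasure_eq_measure)
      then have "AE x in unit_leb. x \<notin> A \<inter> J"
        by (rule AE_not_in)
      then have "AE x in unit_leb. indicator (A \<inter> J) x *\<^sub>R \<phi> x = 0" for \<phi> :: "real \<Rightarrow> real"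
        by eventually_elim simp
      then have "(LINT x:A \<inter> J|unit_leb. \<phi> x) = 0" for \<phi> :: "real \<Rightarrow> real"
        unfolding set_lebesgue_integral_def by (rule integral_eq_zero_AE)
      then show ?thesis by simp
    next
      assume full: "measure unit_leb (A \<inter> J) = measure unit_leb J"
      have "measure unit_leb (J - A \<inter> J) = 0"
        using full AJM JM by (subst unit_leb.finite_measure_Diff) auto
      then have "J - A \<inter> J \<in> null_sets unit_leb"
        using AJM JM by (auto simp: null_sets_def unit_leb.emeasure_eq_measure)
      then have ae: "AE x in unit_leb. x \<in> J \<longleftrightarrow> x \<in> A \<inter> J"
        by (rule AE_mp[OF AE_not_in]) auto
      have "(LINT x:A \<inter> J|unit_leb. f x) = (LINT x:J|unit_leb. f x)"
        using AJM JM by (intro set_integral_cong_set ae) (auto simp: set_borel_measurable_def)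
      also have "\<dots> = d * measure unit_leb J"
        using pos by (simp add: d_def)
      also have "\<dots> = (LINT x:A \<inter> J|unit_leb. d)"
        using AJM by (subst set_integral_const) (auto simp: full)
      finally show ?thesis .
    qed
    then show "(LINT x:A|unit_leb. indicator J x * f x) = (LINT x:A|unit_leb. indicator J x * d)"
      by (simp only: restrict)
  qed
  moreover have "AE x in unit_leb. E (\<lambda>x. indicator J x * f x) x = indicator J x * E f x"
    by (rule real_cond_exp_mult) (auto intro: intJf)
  ultimately show ?thesis
    unfolding d_def[symmetric] by eventually_elim auto
qed

text \<open>The levels of \<open>E id\<close> give the intervals, and monotonicity of \<open>E\<close> on indicators of half lines, which
generate the Borel sets, makes the plateaus of \<open>h\<close> atoms of \<open>G\<close>.\<close>

lemma E_eq_interval_averaging: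
  assumes h: "mono h" "AE x in unit_leb. E (\<lambda>x. x) x = h x"
    and half: "\<And>t. \<exists>g. (mono g \<or> antimono g) \<and>
      (AE x in unit_leb. E (indicator {t<..}) x = g x)"
  shows "\<exists>I a b. (\<forall>k\<in>I. 0 \<le> a k \<and> a k < b k \<and> b k \<le> 1) \<and>
    disjoint_family_on (\<lambda>k. {a k<..<b k}) I \<and>
    (\<forall>f\<in>Linf unit_leb. AE u in unit_leb. E f u = interval_averaging I a b f u)"
proof -
  let ?C = "plateau_levels h" and ?\<psi> = "E (\<lambda>x. x)"
  let ?P = "\<Union>c\<in>?C. plateau h c"
  have C: "countable ?C"
    using h(1) by (rule countable_plateau_levels)
  have inside: "AE u in unit_leb. u \<in> plateau h c \<longrightarrow>
      E f u = interval_average (plateau_inf h c) (plateau_sup h c) f"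
    if c: "c \<in> ?C" and f: "f \<in> Linf unit_leb" for c f
  proof -
    \<comment> \<open>The plateau itself need not belong to \<open>G\<close>; the level set \<open>J\<close> of \<open>E id\<close> does, and differs from it by a
      null set.\<close>
    define J where "J = {x\<in>{0..1}. ?\<psi> x = c}"
    have "{x\<in>space G. ?\<psi> x = c} \<in> sets G" by measurable
    then have J: "J \<in> sets G" by (simp add: J_def)
    note JM = sets_G[OF J]
    let ?a = "plateau_inf h c" and ?b = "plateau_sup h c"
    note ab = plateau_endpoints[OF c]
    have S: "plateau h c \<subseteq> {0..1}" using ab by auto
    then have SM: "plateau h c \<in> sets unit_leb" by (simp add: sets_unit_leb)
    have JS: "AE x in unit_leb. x \<in> plateau h c \<longleftrightarrow> x \<in> J"
      using h(2) AE_unit_leb_in_space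
        AE_unit_leb_not_in_countable[of "{?a, ?b}", OF countable_finite, OF finite.insertI, OF finite.insertI, OF finite.emptyI]
    proof eventually_elim
      case (elim x)
      then show ?case
        using constant_on_plateau[OF h(1) c, of x] plateau_bounds[of x h c]
        by (auto simp: J_def)
    qed
    have mJ: "measure unit_leb J = ?b - ?a"
      using unit_leb.finite_measure_eq_AE[OF JS SM JM] ab by (simp add: measure_unit_leb[OF S])
    have const: "\<exists>d. AE x in unit_leb. x \<in> J \<longrightarrow> E (indicator {t<..}) x = d" for t
    proof -
      from half[of t] obtain g where g: "mono g \<or> antimono g"
        "AE x in unit_leb. E (indicator {t<..}) x = g x" by blast
      have "integrable unit_leb (indicator {t<..} :: real \<Rightarrow> real)"
        by (auto intro!: Linf_integrable mono_in_Linf simp: mono_def indicator_def)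
      then have "integrable unit_leb (E (indicator {t<..}))"
        by (rule real_cond_exp_int)
      moreover have "AE x in unit_leb. x \<in> J \<longrightarrow> ?\<psi> x = c"
        by (rule AE_I2) (simp add: J_def)
      ultimately have "AE x in unit_leb. x \<in> J \<longrightarrow> E (indicator {t<..}) x = g c"
        using monotone_constant_where_barycentre_constant[OF J _ borel_measurable_cond_exp _ g]
        by blast
      then show ?thesis ..
    qed
    have fm [measurable]: "f \<in> borel_measurable unit_leb" using f by (simp add: Linf_def)
    have "(LINT t:J|unit_leb. f t) = (LINT t:plateau h c|unit_leb. f t)"
      using JM SM by (intro set_integral_cong_set JS) (simp_all add: set_borel_measurable_def)
    then have avg: "(LINT t:J|unit_leb. f t) / measure unit_leb J = interval_average ?a ?b f"
      by (simp add: mJ interval_average_def set_integral_unit_leb[OF S])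
    have "AE x in unit_leb. x \<in> J \<longrightarrow> E f x = interval_average ?a ?b f"
      unfolding avg[symmetric] using ab mJ
      by (intro E_on_atom J half_line_constant_imp_atom const Linf_integrable f) auto
    with JS show ?thesis
      by eventually_elim auto
  qed
  have outside: "AE u in unit_leb. u \<notin> ?P \<longrightarrow> E f u = f u" if f: "f \<in> Linf unit_leb" for f
  proof -
    have fm [measurable]: "f \<in> borel_measurable unit_leb" using f by (simp add: Linf_def)
    have [measurable]: "?C \<in> sets borel"
      using C by (rule sets.countable[rotated]) auto
    have [measurable]: "level_section h \<in> measurable borel unit_leb"
      unfolding unit_leb_def using level_section_bounds
      by (intro measurable_restrict_space2)
         (auto intro: borel_measurable_mono[OF mono_level_section])
    \<comment> \<open>Up to null sets \<open>w\<close> is the indicator of the complement of the plateaus, and \<open>F\<close> is a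
      \<open>G\<close>-measurable version of \<open>w f\<close>.\<close>
    define w :: "real \<Rightarrow> real" where "w u = indicator (- ?C) (?\<psi> u)" for u
    define F where "F u = w u * f (level_section h (?\<psi> u))" for u
    have wG: "w \<in> borel_measurable G"
      unfolding w_def by measurable
    have FG: "F \<in> borel_measurable G"
      unfolding F_def w_def by measurable
    have wM: "w \<in> borel_measurable unit_leb" and FM: "F \<in> borel_measurable unit_leb"
      using wG FG measurable_from_subalg[OF subalgebra_G] by auto
    have Ff: "AE u in unit_leb. F u = w u * f u"
      using h(2) AE_unit_leb_in_space
    proof eventually_elim
      case (elim u)
      then show ?case
        using level_section_inverse[OF h(1) elim(2)]
        by (cases "h u \<in> ?C") (simp_all add: F_def w_def)
    qed
    have int: "integrable unit_leb (\<lambda>u. w u * f u)"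
      using wM by (intro Bochner_Integration.integrable_bound[OF Linf_integrable[OF f]])
        (auto simp: w_def indicator_def)
    then have "integrable unit_leb F"
      using Ff FM wM by (subst integrable_cong_AE) auto
    then have "AE u in unit_leb. E F u = F u"
      using FG by (rule real_cond_exp_F_meas)
    moreover have "AE u in unit_leb. E F u = E (\<lambda>u. w u * f u) u"
      using Ff FM wM by (intro real_cond_exp_cong) auto
    moreover have "AE u in unit_leb. E (\<lambda>u. w u * f u) u = w u * E f u"
      using wG int by (intro real_cond_exp_mult) auto
    moreover have "AE u in unit_leb. u \<notin> plateau_inf h ` ?C \<union> plateau_sup h ` ?C"
      using C by (intro AE_unit_leb_not_in_countable) auto
    ultimately show ?thesis
      using Ff h(2) AE_unit_leb_in_space
    proof eventually_elim
      case (elim u)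
      show ?case
      proof
        assume u: "u \<notin> ?P"
        have "h u \<notin> ?C"
        proof
          assume "h u \<in> ?C"
          with u elim plateau_bounds[of u h "h u"] show False by force
        qed
        then have "w u = 1" using elim by (simp add: w_def)
        then show "E f u = f u" using elim by simp
      qed
    qed
  qed
  \<comment> \<open>Renumber the plateaus by natural numbers instead of levels.\<close>
  define I where "I = to_nat_on ?C ` ?C"
  define a where "a k = plateau_inf h (from_nat_into ?C k)" for k
  define b where "b k = plateau_sup h (from_nat_into ?C k)" for k
  have level: "from_nat_into ?C (to_nat_on ?C c) = c" if "c \<in> ?C" for c
    using C that by (rule from_nat_into_to_nat_on)
  have disj: "disjoint_family_on (\<lambda>k. {a k<..<b k}) I"
    using disjoint_plateaus[OF h(1)]
    by (force simp: disjoint_family_on_def I_def a_def b_def level)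
  show ?thesis
  proof (intro exI conjI ballI)
    show "0 \<le> a k" "a k < b k" "b k \<le> 1" if "k \<in> I" for k
      using that plateau_endpoints[of _ h] by (auto simp: I_def a_def b_def level)
    show "disjoint_family_on (\<lambda>k. {a k<..<b k}) I" by (fact disj)
    fix f assume f: "f \<in> Linf unit_leb"
    have "AE u in unit_leb. \<forall>c\<in>?C. u \<in> plateau h c \<longrightarrow>
        E f u = interval_average (plateau_inf h c) (plateau_sup h c) f"
      using inside f C by (subst AE_ball_countable) auto
    with outside[OF f] AE_unit_leb_in_space
    show "AE u in unit_leb. E f u = interval_averaging I a b f u"
    proof eventually_elim
      case (elim u)
      show ?case
      proof (cases "u \<in> ?P")
        case True
        then obtain c where c: "c \<in> ?C" "u \<in> plateau h c" by auto
        have "interval_averaging I a b f u =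
            interval_average (a (to_nat_on ?C c)) (b (to_nat_on ?C c)) f"
          using c by (intro interval_averaging_inside[OF disj]) (auto simp: I_def a_def b_def level)
        then show ?thesis
          using elim c by (simp add: a_def b_def level)
      next
        case False
        then have "u \<notin> (\<Union>k\<in>I. {a k<..<b k})"
          by (auto simp: I_def a_def b_def level)
        then show ?thesis
          using elim False by (simp add: interval_averaging_outside)
      qed
    qed
  qed
qed

end

section \<open>The characterisation\<close>

lemma monotone_cond_exp_operator_imp_interval_averaging:
  assumes G: "subalgebra unit_leb G"
    and T: "\<And>f. f \<in> Linf unit_leb \<Longrightarrow> AE u in unit_leb. T f u = real_cond_exp unit_leb G f u"
    and mon: "preserves_monotonicity T \<or> reverses_monotonicity T"
  shows "\<exists>I a b. (\<forall>k\<in>I. 0 \<le> a k \<and> a k < b k \<and> b k \<le> 1) \<and>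
    disjoint_family_on (\<lambda>k. {a k<..<b k}) I \<and>
    (\<forall>f\<in>Linf unit_leb. AE u in unit_leb. T f u = interval_averaging I a b f u)"
proof -
  interpret unit_subalgebra G
    by (rule unit_subalgebra.intro) (fact G)
  \<comment> \<open>The hypothesis on \<open>T\<close> speaks of decreasing functions; it is applied to \<open>- f\<close> for \<open>f\<close> increasing.\<close>
  have dual: "AE u in unit_leb. - T (\<lambda>u. - f u) u = E f u" and
    dec: "ae_decreasing (\<lambda>u. - f u)" "(\<lambda>u. - f u) \<in> Linf unit_leb" if "mono f" for f
  proof -
    note f = mono_in_Linf[OF that]
    show "(\<lambda>u. - f u) \<in> Linf unit_leb" using f by (rule uminus_in_Linf)
    have "AE u in unit_leb. E (\<lambda>u. - f u) u = - E f u"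
      using real_cond_exp_cmult[OF Linf_integrable[OF f], of "-1"] by simp
    with T[OF \<open>(\<lambda>u. - f u) \<in> Linf unit_leb\<close>]
    show "AE u in unit_leb. - T (\<lambda>u. - f u) u = E f u"
      by eventually_elim simp
    have "antimono (\<lambda>u. - f u)" using that by (simp add: monotone_def)
    then show "ae_decreasing (\<lambda>u. - f u)" by (auto simp: ae_decreasing_iff_antimono)
  qed
  have pres: "\<exists>g. mono g \<and> (AE u in unit_leb. E f u = g u)"
    if "preserves_monotonicity T" "mono f" for f
  proof -
    have "ae_decreasing (T (\<lambda>u. - f u))"
      using that dec[of f] by (simp add: preserves_monotonicity_def)
    then obtain g where g: "antimono g" "AE u in unit_leb. T (\<lambda>u. - f u) u = g u"
      by (auto simp: ae_decreasing_iff_antimono)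
    have "AE u in unit_leb. E f u = - g u"
      using g(2) dual[OF that(2)] by eventually_elim simp
    moreover have "mono (\<lambda>u. - g u)" using g(1) by (simp add: monotone_def)
    ultimately show ?thesis by blast
  qed
  have rev: "\<exists>g. antimono g \<and> (AE u in unit_leb. E f u = g u)"
    if "reverses_monotonicity T" "mono f" for f
  proof -
    have "ae_increasing (T (\<lambda>u. - f u))"
      using that dec[of f] by (simp add: reverses_monotonicity_def)
    then obtain g where g: "mono g" "AE u in unit_leb. T (\<lambda>u. - f u) u = g u"
      by (auto simp: ae_increasing_iff_mono)
    have "AE u in unit_leb. E f u = - g u"
      using g(2) dual[OF that(2)] by eventually_elim simp
    moreover have "antimono (\<lambda>u. - g u)" using g(1) by (simp add: monotone_def)
    ultimately show ?thesis by blast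
  qed
  have ident: "mono (\<lambda>x::real. x)" by (simp add: mono_def)
  have "\<exists>h. mono h \<and> (AE x in unit_leb. E (\<lambda>x. x) x = h x)"
    using mon
  proof
    assume "preserves_monotonicity T"
    then show ?thesis using pres ident by blast
  next
    assume "reverses_monotonicity T"
    then obtain h where "antimono h" "AE x in unit_leb. E (\<lambda>x. x) x = h x"
      using rev ident by blast
    then obtain m where "AE x in unit_leb. E (\<lambda>x. x) x = m"
      using antimono_barycentre_constant by blast
    then show ?thesis
      by (intro exI[of _ "\<lambda>_. m"]) (simp add: mono_def)
  qed
  then obtain h where h: "mono h" "AE x in unit_leb. E (\<lambda>x. x) x = h x" by blast
  have ind: "mono (indicator {t<..} :: real \<Rightarrow> real)" for t :: real
    by (auto simp: mono_def indicator_def)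
  have half: "\<exists>g. (mono g \<or> antimono g) \<and> (AE x in unit_leb. E (indicator {t<..}) x = g x)" for t
    using mon pres[OF _ ind[of t]] rev[OF _ ind[of t]] by blast
  have "(AE u in unit_leb. T f u = \<phi> u) \<longleftrightarrow> (AE u in unit_leb. E f u = \<phi> u)"
    if "f \<in> Linf unit_leb" for f and \<phi> :: "real \<Rightarrow> real"
  proof
    show "AE u in unit_leb. E f u = \<phi> u" if "AE u in unit_leb. T f u = \<phi> u"
      using T[OF \<open>f \<in> Linf unit_leb\<close>] that by eventually_elim simp
    show "AE u in unit_leb. T f u = \<phi> u" if "AE u in unit_leb. E f u = \<phi> u"
      using T[OF \<open>f \<in> Linf unit_leb\<close>] that by eventually_elim simp
  qed
  then show ?thesis
    using E_eq_interval_averaging[OF h half] by simp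
qed

theorem theorem5p10:
  fixes T :: "(real \<Rightarrow> real) \<Rightarrow> (real \<Rightarrow> real)"
  assumes "cond_exp_operator unit_leb T"
  shows "preserves_monotonicity T \<or> reverses_monotonicity T \<longleftrightarrow>
    (\<exists>(I :: nat set) (a :: nat \<Rightarrow> real) (b :: nat \<Rightarrow> real).
       (\<forall>k \<in> I. 0 \<le> a k \<and> a k < b k \<and> b k \<le> 1) \<and>
       disjoint_family_on (\<lambda>k. {a k<..<b k}) I \<and>
       (let P = (\<Union>k\<in>I. {a k<..<b k}) in
        \<forall>f \<in> Linf unit_leb. AE u in unit_leb.
          T f u =
            (\<Sum>\<^sub>\<infinity>k\<in>I. indicator {a k<..<b k} u *
               (1 / (b k - a k) * (LINT t:{a k<..<b k}|lborel. f t)))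
            + indicator ({0..1} - P) u * f u))"
  unfolding Let_def interval_average_def[symmetric] interval_averaging_def[symmetric]
proof
  from assms obtain G where G: "subalgebra unit_leb G"
    and "\<forall>f\<in>Linf unit_leb. AE u in unit_leb. T f u = real_cond_exp unit_leb G f u"
    unfolding cond_exp_operator_def by (elim conjE exE)
  then have E: "AE u in unit_leb. T f u = real_cond_exp unit_leb G f u" if "f \<in> Linf unit_leb" for f
    using that by simp
  assume "preserves_monotonicity T \<or> reverses_monotonicity T"
  with G E show "\<exists>I a b. (\<forall>k\<in>I. 0 \<le> a k \<and> a k < b k \<and> b k \<le> 1) \<and>
      disjoint_family_on (\<lambda>k. {a k<..<b k}) I \<and>
      (\<forall>f\<in>Linf unit_leb. AE u in unit_leb. T f u = interval_averaging I a b f u)"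
    by (rule monotone_cond_exp_operator_imp_interval_averaging)
next
  assume "\<exists>I a b. (\<forall>k\<in>I. 0 \<le> a k \<and> a k < b k \<and> b k \<le> 1) \<and>
      disjoint_family_on (\<lambda>k. {a k<..<b k}) I \<and>
      (\<forall>f\<in>Linf unit_leb. AE u in unit_leb. T f u = interval_averaging I a b f u)"
  then show "preserves_monotonicity T \<or> reverses_monotonicity T"
    using preserves_monotonicity_interval_averaging by blast
qed

end
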